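(* For every finite-dimensional $\mathbb Z$-graded chart $U=(\underline U,V)$ one has $\mathcal F_1(U)=\mathcal F(U)$; that is, every element of $\mathcal F(U)$ is a finite sum of products of a polynomial in the non-zero degree variables with a formal power series in finitely many monomials of total degree $0$ (with coefficients smooth in the degree zero variables).
   Context: A (finite-dimensional, smooth, $\mathbb Z$-)graded chart is a pair $U=(\underline U,V)$, where $\underline U\subseteq\mathbb R^n$ is open with coordinates $x$ of degree $0$, and $V=\bigoplus_{i\in\mathbb Z\setminus\{0\}}V_i$ is a finite-dimensional $\mathbb Z$-graded real vector space with no degree $0$ part. $V$ has homogeneous coordinates of non-zero integer degrees: even-degree ones $\zeta_1,\dots,\zeta_{D_1}$ and odd-degree ones $\eta_1,\dots,\eta_{D_2}$. Variables commute up to the sign $ab=(-1)^{\deg a\deg b}ba$; in particular the $\eta$'s anticommute and square to zero. $\mathcal F(U)_k$ is the space of formal power series $$f=\sum_{i_1,\dots,i_{D_1}\ge 0;\ j_1,\dots,j_{D_2}\in\{0,1\}} f_{i_1\dots i_{D_1}j_1\dots j_{D_2}}(x)\,\zeta_1^{i_1}\cdots\zeta_{D_1}^{i_{D_1}}\eta_1^{j_1}\cdots\eta_{D_2}^{j_{D_2}},$$ with coefficients in $C^\infty(\underline U)$, in which only monomials with $\sum_\alpha i_\alpha\deg\zeta_\alpha+\sum_\alpha j_\alpha\deg\eta_\alpha=k$ occur, and $\mathcal F(U)=\bigoplus_{k\in\mathbb Z}\mathcal F(U)_k$ (finite sums of homogeneous elements). $\mathcal F_1(U)\subseteq\mathcal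 F(U)$ is the set of finite sums $\sum_s p_s\cdot F_s(x,z_1,\dots,z_r)$, where each $p_s$ is a polynomial in the $\zeta$'s and $\eta$'s, $z_1,\dots,z_r$ is a finite collection of non-constant monomials in the $\zeta$'s and $\eta$'s of total degree $0$, and each $F_s(x,z_1,\dots,z_r)=\sum_{i_1,\dots,i_r\ge0}F_{s;i_1\dots i_r}(x)z_1^{i_1}\cdots z_r^{i_r}$ is a formal power series in these monomials with coefficients in $C^\infty(\underline U)$. *)

theory Defs
  imports "HOL-Analysis.Analysis"
begin

section \<open>Smooth functions on open subsets of Euclidean space\<close>

text \<open>
  \<open>\<real>\<^sup>n\<close> is the carrier of \<^const>\<open>Euclidean_space\<close>, i.e. the sequences that vanish from index
  \<open>n\<close> on.  Unlike a type-indexed \<open>real^'n\<close> this includes \<open>n = 0\<close>.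
\<close>

type_synonym point = "nat \<Rightarrow> real"

definition partial_deriv :: "nat \<Rightarrow> (point \<Rightarrow> real) \<Rightarrow> point \<Rightarrow> real" where
  "partial_deriv i f x = deriv (\<lambda>t. f (x(i := t))) (x i)"

definition smooth_on :: "nat \<Rightarrow> point set \<Rightarrow> (point \<Rightarrow> real) \<Rightarrow> bool" where
  "smooth_on n U f \<longleftrightarrow>
     (\<forall>is. set is \<subseteq> {..<n} \<longrightarrow>
        continuous_map (subtopology (Euclidean_space n) U) euclideanreal (foldr partial_deriv is f) \<and>
        (\<forall>i<n. \<forall>x\<in>U. (\<lambda>t. foldr partial_deriv is f (x(i := t))) differentiable (at (x i))))"

text \<open>Extension by zero outside \<open>U\<close> makes equality of functions on \<open>U\<close> equality in HOL.\<close>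

definition smooth_functions :: "nat \<Rightarrow> point set \<Rightarrow> (point \<Rightarrow> real) set" where
  "smooth_functions n U = {f. smooth_on n U f \<and> (\<forall>x. x \<notin> U \<longrightarrow> f x = 0)}"


section \<open>Graded charts\<close>

text \<open>\<open>component C i\<close> is the component \<open>V\<^sub>i\<close>; the space \<open>V\<close> itself is the whole type \<open>'v\<close>.\<close>

record 'v chart =
  base_dim :: nat
  base :: "point set"
  component :: "int \<Rightarrow> 'v set"

definition direct_sum_decomposition :: "(int \<Rightarrow> 'v::real_vector set) \<Rightarrow> bool" where
  "direct_sum_decomposition V \<longleftrightarrow>
     (\<forall>i. subspace (V i)) \<and>
     (\<forall>v. \<exists>!c. (\<forall>i. c i \<in> V i) \<and> finite {i. c i \<noteq> 0} \<and> v = (\<Sum>i | c i \<noteq> 0. c i))"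

definition graded_chart :: "('v::real_vector, 'b) chart_scheme \<Rightarrow> bool" where
  "graded_chart C \<longleftrightarrow>
     openin (Euclidean_space (base_dim C)) (base C) \<and>
     (\<exists>B :: 'v set. finite B \<and> span B = UNIV) \<and>
     direct_sum_decomposition (component C) \<and>
     component C 0 = {0}"

text \<open>
  A choice of homogeneous linear coordinates \<open>\<zeta>\<^sub>\<alpha>\<close> (\<open>\<alpha> < n_even\<close>) and \<open>\<eta>\<^sub>\<beta>\<close> (\<open>\<beta> < n_odd\<close>) on \<open>V\<close>.
  Indices start at \<open>0\<close>.
\<close>

record 'v coord_chart = "'v chart" +
  n_even :: nat
  n_odd :: nat
  zeta :: "nat \<Rightarrow> 'v \<Rightarrow> real"
  eta :: "nat \<Rightarrow> 'v \<Rightarrow> real"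
  deg_zeta :: "nat \<Rightarrow> int"
  deg_eta :: "nat \<Rightarrow> int"

text \<open>
  A linear functional has degree \<open>d\<close> if it is supported on \<open>V\<^sub>d\<close>.  (With the opposite convention,
  \<open>V\<^sub>-\<^sub>d\<close>, one obtains the same notions for the chart with the grading of \<open>V\<close> reversed.)
\<close>

definition homogeneous_functional :: "(int \<Rightarrow> 'v::real_vector set) \<Rightarrow> ('v \<Rightarrow> real) \<Rightarrow> int \<Rightarrow> bool" where
  "homogeneous_functional V \<phi> d \<longleftrightarrow> linear \<phi> \<and> (\<forall>i v. i \<noteq> d \<longrightarrow> v \<in> V i \<longrightarrow> \<phi> v = 0)"

text \<open>The last conjunct says that the coordinates identify \<open>V\<close> with \<open>\<real>\<^bsup>n_even + n_odd\<^esup>\<close>.\<close>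

definition homogeneous_coordinates :: "('v::real_vector, 'b) coord_chart_scheme \<Rightarrow> bool" where
  "homogeneous_coordinates C \<longleftrightarrow>
     (\<forall>\<alpha><n_even C. deg_zeta C \<alpha> \<noteq> 0 \<and> even (deg_zeta C \<alpha>) \<and>
        homogeneous_functional (component C) (zeta C \<alpha>) (deg_zeta C \<alpha>)) \<and>
     (\<forall>\<beta><n_odd C. odd (deg_eta C \<beta>) \<and>
        homogeneous_functional (component C) (eta C \<beta>) (deg_eta C \<beta>)) \<and>
     (\<forall>a b. \<exists>!v. (\<forall>\<alpha><n_even C. zeta C \<alpha> v = a \<alpha>) \<and> (\<forall>\<beta><n_odd C. eta C \<beta> v = b \<beta>))"


section \<open>Monomials and graded-commutative multiplication\<close>

text \<open>
  The pair \<open>(i, J)\<close> stands for \<open>\<zeta>\<^sub>0\<^bsup>i 0\<^esup> \<zeta>\<^sub>1\<^bsup>i 1\<^esup> \<dots>\<close> times the product of the \<open>\<eta>\<^sub>\<beta>\<close>,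
  \<open>\<beta> \<in> J\<close>, taken in increasing order of \<open>\<beta>\<close>; thus \<open>J\<close> is the set of indices with \<open>j\<^sub>\<beta> = 1\<close>.
\<close>

type_synonym mono = "(nat \<Rightarrow> nat) \<times> nat set"

definition mono_one :: mono where
  "mono_one = ((\<lambda>_. 0), {})"

definition monomials :: "('v, 'b) coord_chart_scheme \<Rightarrow> mono set" where
  "monomials C = {(i, J). (\<forall>\<alpha>\<ge>n_even C. i \<alpha> = 0) \<and> J \<subseteq> {..<n_odd C}}"

definition mono_degree :: "('v, 'b) coord_chart_scheme \<Rightarrow> mono \<Rightarrow> int" where
  "mono_degree C m =
     (\<Sum>\<alpha><n_even C. int (fst m \<alpha>) * deg_zeta C \<alpha>) + (\<Sum>\<beta>\<in>snd m. deg_eta C \<beta>)"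

text \<open>
  \<open>(\<zeta>\<^sup>i \<eta>\<^sub>J) (\<zeta>\<^sup>i\<^sup>' \<eta>\<^sub>K)\<close> vanishes if \<open>J\<close> and \<open>K\<close> meet; otherwise it is \<open>\<zeta>\<^bsup>i+i'\<^esup> \<eta>\<^bsub>J \<union> K\<^esub>\<close> with the
  sign that sorts the odd factors: one transposition for each pair \<open>j \<in> J\<close>, \<open>k \<in> K\<close> with
  \<open>k < j\<close>.  Even variables commute with everything.
\<close>

definition mono_mult :: "mono \<Rightarrow> mono \<Rightarrow> mono" where
  "mono_mult a b = ((\<lambda>\<alpha>. fst a \<alpha> + fst b \<alpha>), snd a \<union> snd b)"

definition mono_sign :: "mono \<Rightarrow> mono \<Rightarrow> real" where
  "mono_sign a b =
     (if snd a \<inter> snd b = {} then (- 1) ^ card {(j, k). j \<in> snd a \<and> k \<in> snd b \<and> k < j} else 0)"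

text \<open>Formal power series with real coefficients, as coefficient functions.\<close>

type_synonym rseries = "mono \<Rightarrow> real"

definition single :: "mono \<Rightarrow> rseries" where
  "single m = (\<lambda>m'. if m' = m then 1 else 0)"

definition series_mult :: "('v, 'b) coord_chart_scheme \<Rightarrow> rseries \<Rightarrow> rseries \<Rightarrow> rseries" where
  "series_mult C f g m =
     (\<Sum>(a, b) \<in> {(a, b). a \<in> monomials C \<and> b \<in> monomials C \<and> mono_mult a b = m}. mono_sign a b * f a * g b)"

primrec series_power :: "('v, 'b) coord_chart_scheme \<Rightarrow> rseries \<Rightarrow> nat \<Rightarrow> rseries" where
  "series_power C f 0 = single mono_one"
| "series_power C f (Suc n) = series_mult C f (series_power C f n)"

definition polynomials :: "('v, 'b) coord_chart_scheme \<Rightarrow> rseries set" where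
  "polynomials C = {p. finite {m. p m \<noteq> 0} \<and> {m. p m \<noteq> 0} \<subseteq> monomials C}"


section \<open>The function spaces\<close>

text \<open>\<open>f m\<close> is the coefficient function of the monomial \<open>m\<close>.\<close>

type_synonym series = "mono \<Rightarrow> point \<Rightarrow> real"

definition F_homogeneous :: "('v, 'b) coord_chart_scheme \<Rightarrow> int \<Rightarrow> series set" where
  "F_homogeneous C k =
     {f. (\<forall>m. f m \<in> smooth_functions (base_dim C) (base C)) \<and>
         (\<forall>m. m \<notin> monomials C \<or> mono_degree C m \<noteq> k \<longrightarrow> f m = (\<lambda>_. 0))}"

definition F_all :: "('v, 'b) coord_chart_scheme \<Rightarrow> series set" where
  "F_all C =
     {f. \<exists>K g. finite K \<and> (\<forall>k\<in>K. g k \<in> F_homogeneous C k) \<and> f = (\<lambda>m x. \<Sum>k\<in>K. g k m x)}"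

text \<open>\<open>z\<^sub>1\<^bsup>i\<^sub>1\<^esup> \<dots> z\<^sub>r\<^bsup>i\<^sub>r\<^esup>\<close> for \<open>zs = [z\<^sub>1, \<dots>, z\<^sub>r]\<close> and \<open>is = [i\<^sub>1, \<dots>, i\<^sub>r]\<close>, signs included.\<close>

definition z_power :: "('v, 'b) coord_chart_scheme \<Rightarrow> mono list \<Rightarrow> nat list \<Rightarrow> rseries" where
  "z_power C zs is =
     foldr (series_mult C) (map2 (\<lambda>z i. series_power C (single z) i) zs is) (single mono_one)"

text \<open>
  \<open>F(x, z\<^sub>1, \<dots>, z\<^sub>r)\<close>, where \<open>F is\<close> is the coefficient of \<open>z\<^sup>i\<^sup>s\<close>.  Only those multi-indices contribute
  to the coefficient of \<open>m\<close> for which \<open>m\<close> occurs in the power; for non-constant \<open>z\<close>'s these are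
  finitely many, see \<open>finite_z_power_support\<close> below.
\<close>

definition substitute ::
  "('v, 'b) coord_chart_scheme \<Rightarrow> mono list \<Rightarrow> (nat list \<Rightarrow> point \<Rightarrow> real) \<Rightarrow> series" where
  "substitute C zs F m x =
     (\<Sum>is | length is = length zs \<and> z_power C zs is m \<noteq> 0. F is x * z_power C zs is m)"

definition poly_times :: "('v, 'b) coord_chart_scheme \<Rightarrow> rseries \<Rightarrow> series \<Rightarrow> series" where
  "poly_times C p f m x = series_mult C p (\<lambda>m'. f m' x) m"

definition F_one :: "('v, 'b) coord_chart_scheme \<Rightarrow> series set" where
  "F_one C =
     {f. \<exists>zs N p F.
        (\<forall>z \<in> set zs. z \<in> monomials C \<and> z \<noteq> mono_one \<and> mono_degree C z = 0) \<and>
        (\<forall>s<N. p s \<in> polynomials C) \<and>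
        (\<forall>s<N. \<forall>is. length is = length zs \<longrightarrow> F s is \<in> smooth_functions (base_dim C) (base C)) \<and>
        f = (\<lambda>m x. \<Sum>s<(N::nat). poly_times C (p s) (substitute C zs (F s)) m x)}"


section \<open>The sums above are finite\<close>

lemma finite_mono_factorizations:
  assumes "m \<in> monomials C"
  shows "finite {(a, b). a \<in> monomials C \<and> b \<in> monomials C \<and> mono_mult a b = m}"
proof -
  obtain i J where m: "m = (i, J)" by force
  let ?E = "{e. \<forall>\<alpha>. (\<alpha> \<in> {..<n_even C} \<longrightarrow> e \<alpha> \<in> {..sum i {..<n_even C}}) \<and>
                 (\<alpha> \<notin> {..<n_even C} \<longrightarrow> e \<alpha> = (0::nat))}"
  have fin: "finite (?E \<times> Pow {..<n_odd C})"
    by (intro finite_cartesian_product finite_set_of_finite_funs) auto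
  have in1: "a \<in> ?E \<times> Pow {..<n_odd C}" if "a \<in> monomials C" "\<And>\<alpha>. fst a \<alpha> \<le> i \<alpha>" for a
  proof -
    have "fst a \<alpha> \<le> sum i {..<n_even C}" if "\<alpha> < n_even C" for \<alpha>
      using \<open>fst a \<alpha> \<le> i \<alpha>\<close> member_le_sum[of \<alpha> "{..<n_even C}" i] that by auto
    then show ?thesis using \<open>a \<in> monomials C\<close> by (auto simp: monomials_def)
  qed
  have "{(a, b). a \<in> monomials C \<and> b \<in> monomials C \<and> mono_mult a b = m}
        \<subseteq> (?E \<times> Pow {..<n_odd C}) \<times> (?E \<times> Pow {..<n_odd C})"
  proof (rule subsetI)
    fix ab
    assume "ab \<in> {(a, b). a \<in> monomials C \<and> b \<in> monomials C \<and> mono_mult a b = m}"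
    then obtain a b where ab: "ab = (a, b)" "a \<in> monomials C" "b \<in> monomials C" "m = mono_mult a b"
      by auto
    then have "fst a \<alpha> \<le> i \<alpha>" "fst b \<alpha> \<le> i \<alpha>" for \<alpha>
      using m by (auto simp: mono_mult_def)
    with in1[of a] in1[of b] ab
    show "ab \<in> (?E \<times> Pow {..<n_odd C}) \<times> (?E \<times> Pow {..<n_odd C})" by simp
  qed
  then show ?thesis using fin by (meson finite_SigmaI finite_subset)
qed

definition mono_size :: "('v, 'b) coord_chart_scheme \<Rightarrow> mono \<Rightarrow> nat" where
  "mono_size C m = (\<Sum>\<alpha><n_even C. fst m \<alpha>) + card (snd m)"

lemma series_mult_nonzeroE:
  assumes "series_mult C f g m \<noteq> 0"
  obtains a b where "f a \<noteq> 0" "g b \<noteq> 0" "mono_size C m = mono_size C a + mono_size C b"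
proof -
  from assms obtain a b where ab: "a \<in> monomials C" "b \<in> monomials C" "mono_mult a b = m"
      "mono_sign a b * f a * g b \<noteq> 0"
    unfolding series_mult_def by (auto elim!: sum.not_neutral_contains_not_neutral)
  then have "snd a \<inter> snd b = {}" by (auto simp: mono_sign_def split: if_splits)
  moreover have "finite (snd a)" "finite (snd b)"
    using ab by (auto simp: monomials_def dest: finite_subset[OF _ finite_lessThan])
  ultimately have "mono_size C m = mono_size C a + mono_size C b"
    using ab(3) by (auto simp: mono_size_def mono_mult_def sum.distrib card_Un_disjoint)
  with that[of a b] ab(4) show thesis by simp
qed

lemma series_power_single_size:
  "series_power C (single z) n m \<noteq> 0 \<Longrightarrow> mono_size C m = n * mono_size C z"
proof (induction n arbitrary: m)
  case 0
  then show ?case by (auto simp: single_def mono_one_def mono_size_def split: if_splits)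
next
  case (Suc n)
  then show ?case
    by (auto simp: single_def elim!: series_mult_nonzeroE split: if_splits)
qed

lemma z_power_size:
  assumes "length is = length zs" "z_power C zs is m \<noteq> 0"
  shows "mono_size C m = (\<Sum>(z, i) \<leftarrow> zip zs is. i * mono_size C z)"
  using assms
proof (induction zs "is" arbitrary: m rule: list_induct2')
  case 1
  then show ?case
    by (auto simp: z_power_def single_def mono_one_def mono_size_def split: if_splits)
next
  case (4 z zs i "is")
  then have "series_mult C (series_power C (single z) i) (z_power C zs is) m \<noteq> 0"
    by (simp add: z_power_def)
  then show ?case
    by (rule series_mult_nonzeroE) (use 4 in \<open>auto dest: series_power_single_size\<close>)
qed auto

lemma finite_z_power_support:
  assumes "\<And>z. z \<in> set zs \<Longrightarrow> z \<in> monomials C \<and> z \<noteq> mono_one"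
  shows "finite {is. length is = length zs \<and> z_power C zs is m \<noteq> 0}"
proof -
  have pos: "mono_size C z \<ge> 1" if z: "z \<in> set zs" for z
  proof (rule ccontr)
    assume "\<not> ?thesis"
    then have 0: "mono_size C z = 0" by simp
    obtain i J where zz: "z = (i, J)" by force
    have J: "finite J" "\<forall>\<alpha>\<ge>n_even C. i \<alpha> = 0"
      using assms[OF z] zz by (auto simp: monomials_def intro: finite_subset)
    then have "J = {}" "\<forall>\<alpha><n_even C. i \<alpha> = 0" using 0 zz by (auto simp: mono_size_def)
    then have "z = mono_one" using J zz by (auto simp: mono_one_def fun_eq_iff) (meson not_le)
    then show False using assms[OF z] by simp
  qed
  have "{is. length is = length zs \<and> z_power C zs is m \<noteq> 0}
        \<subseteq> {is. set is \<subseteq> {..mono_size C m} \<and> length is = length zs}"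
  proof (intro subsetI CollectI conjI)
    fix "is" i
    assume "is \<in> {is. length is = length zs \<and> z_power C zs is m \<noteq> 0}" and "i \<in> set is"
    then have *: "length is = length zs" "z_power C zs is m \<noteq> 0" "i \<in> set is" by auto
    then obtain l where l: "l < length is" "is ! l = i" by (auto simp: in_set_conv_nth)
    let ?xs = "map (\<lambda>(z, i). i * mono_size C z) (zip zs is)"
    have "i * mono_size C (zs ! l) = ?xs ! l" using l * by simp
    also have "\<dots> \<le> sum_list ?xs" by (rule elem_le_sum_list) (use l * in simp)
    also have "\<dots> = mono_size C m" using z_power_size[OF *(1,2)] by simp
    finally have "i * mono_size C (zs ! l) \<le> mono_size C m" .
    moreover have "i * 1 \<le> i * mono_size C (zs ! l)"
      using pos[of "zs ! l"] l * by (intro mult_le_mono) auto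
    ultimately have "i * 1 \<le> mono_size C m" by (rule order_trans[rotated])
    then show "i \<in> {..mono_size C m}" by (simp only: atMost_iff mult_1_right)
  qed auto
  then show ?thesis by (rule finite_subset) (auto intro: finite_lists_length_eq)
qed

end

theory Submission
  imports Defs
begin

text \<open>
  If \<open>\<zeta>\<^sub>\<alpha>\<close> has degree \<open>d > 0\<close> and \<open>\<zeta>\<^sub>\<beta>\<close> has degree \<open>- e < 0\<close>, then \<open>\<zeta>\<^sub>\<alpha>\<^sup>e \<zeta>\<^sub>\<beta>\<^sup>d\<close> has degree \<open>0\<close>.  Divide a
  monomial by these finitely many monomials as often as possible.  In the remainder the exponents
  of all variables of positive degree, or of all those of negative degree, are bounded; for a fixed
  total degree this bounds the other exponents as well.  So only finitely many remainders occur, and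
  a series \<open>f\<close> is the sum, over the remainders \<open>r\<close>, of \<open>r\<close> times a power series in these monomials.
  They contain no odd variables, so no signs appear.
\<close>

section \<open>Linear combinations of smooth functions\<close>

text \<open>Lets an identity known only on \<open>U\<close> be differentiated: near \<open>x\<close>
  the coordinate line stays inside \<open>U\<close>.\<close>

lemma eventually_fun_upd_in_open:
  assumes "openin (Euclidean_space n) U" "x \<in> U" "i < n"
  shows "\<forall>\<^sub>F t in nhds (x i). x(i := t) \<in> U"
proof -
  have x: "x \<in> topspace (Euclidean_space n)"
    using assms openin_subset by blast
  have "continuous_map euclideanreal (Euclidean_space n) (\<lambda>t. x(i := t))"
    unfolding Euclidean_space_def continuous_map_in_subtopology continuous_map_componentwise_UNIV
    using x assms(3) by (auto simp: topspace_Euclidean_space fun_upd_def)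
  then have "openin euclideanreal {t \<in> topspace euclideanreal. x(i := t) \<in> U}"
    using assms(1) by (rule openin_continuous_map_preimage)
  then have "open {t. x(i := t) \<in> U}" by simp
  then show ?thesis
    using assms(2) eventually_nhds_in_open[of "{t. x(i := t) \<in> U}" "x i"] by simp
qed

text \<open>Linearity of \<open>deriv\<close> requires differentiability, which
  \<open>smooth_on\<close> grants only at points of \<open>U\<close>. The induction hypothesis is
  likewise known only on \<open>U\<close>, but \<open>deriv\<close> sees only values near
  \<open>x i\<close>.\<close>

lemma foldr_partial_deriv_linear:
  assumes "openin (Euclidean_space n) U" "smooth_on n U f" "smooth_on n U g"
    and "set is \<subseteq> {..<n}" "x \<in> U"
  shows "foldr partial_deriv is (\<lambda>x. a * f x + b * g x) x =
         a * foldr partial_deriv is f x + b * foldr partial_deriv is g x"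
  using assms(4,5)
proof (induction "is" arbitrary: x)
  case (Cons i "is")
  let ?L = "\<lambda>h. foldr partial_deriv is h"
  have i: "i < n" "set is \<subseteq> {..<n}" using Cons.prems by auto
  have "\<forall>\<^sub>F t in nhds (x i). ?L (\<lambda>x. a * f x + b * g x) (x(i := t)) =
                            a * ?L f (x(i := t)) + b * ?L g (x(i := t))"
    using eventually_fun_upd_in_open[OF assms(1) Cons.prems(2) i(1)]
    by (rule eventually_mono) (use Cons.IH i in auto)
  then have "deriv (\<lambda>t. ?L (\<lambda>x. a * f x + b * g x) (x(i := t))) (x i) =
             deriv (\<lambda>t. a * ?L f (x(i := t)) + b * ?L g (x(i := t))) (x i)"
    by (rule deriv_cong_ev) simp
  also have "\<dots> = a * deriv (\<lambda>t. ?L f (x(i := t))) (x i) + b * deriv (\<lambda>t. ?L g (x(i := t))) (x i)"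
  proof (rule DERIV_imp_deriv)
    have "DERIV (\<lambda>t. ?L h (x(i := t))) (x i) :> deriv (\<lambda>t. ?L h (x(i := t))) (x i)"
      if "smooth_on n U h" for h
      using that i Cons.prems(2) unfolding smooth_on_def
      by (simp add: DERIV_deriv_iff_real_differentiable)
    then show "DERIV (\<lambda>t. a * ?L f (x(i := t)) + b * ?L g (x(i := t))) (x i) :>
      a * deriv (\<lambda>t. ?L f (x(i := t))) (x i) + b * deriv (\<lambda>t. ?L g (x(i := t))) (x i)"
      using assms(2,3) by (intro DERIV_add DERIV_cmult)
  qed
  finally show ?case by (simp add: partial_deriv_def[of i])
qed simp

lemma smooth_on_linear:
  assumes U: "openin (Euclidean_space n) U" and f: "smooth_on n U f" and g: "smooth_on n U g"
  shows "smooth_on n U (\<lambda>x. a * f x + b * g x)"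
  unfolding smooth_on_def
proof (intro allI impI conjI ballI)
  fix "is" assume "is": "set is \<subseteq> {..<n}"
  let ?L = "\<lambda>h. foldr partial_deriv is h"
  note eq = foldr_partial_deriv_linear[OF U f g "is"]
  have cont: "continuous_map (subtopology (Euclidean_space n) U) euclideanreal (?L f)"
             "continuous_map (subtopology (Euclidean_space n) U) euclideanreal (?L g)"
    using f g "is" unfolding smooth_on_def by blast+
  show "continuous_map (subtopology (Euclidean_space n) U) euclideanreal
          (?L (\<lambda>x. a * f x + b * g x))"
    by (rule continuous_map_eq[where f = "\<lambda>x. a * ?L f x + b * ?L g x"])
       (use eq cont in \<open>auto intro!: continuous_map_add continuous_map_real_mult_left\<close>)
  fix i x assume i: "i < n" and x: "x \<in> U"
  have "(\<lambda>t. ?L f (x(i := t))) differentiable (at (x i))"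
       "(\<lambda>t. ?L g (x(i := t))) differentiable (at (x i))"
    using f g "is" i x unfolding smooth_on_def by blast+
  then have "(\<lambda>t. a * ?L f (x(i := t)) + b * ?L g (x(i := t))) differentiable (at (x i))"
    by (intro derivative_intros)
  then obtain D where
    "((\<lambda>t. a * ?L f (x(i := t)) + b * ?L g (x(i := t))) has_real_derivative D) (at (x i))"
    by (auto simp: real_differentiable_def)
  moreover have "\<forall>\<^sub>F t in nhds (x i). ?L (\<lambda>x. a * f x + b * g x) (x(i := t)) =
                            a * ?L f (x(i := t)) + b * ?L g (x(i := t))"
    using eventually_fun_upd_in_open[OF U x i] by (rule eventually_mono) (use eq in auto)
  ultimately show "(\<lambda>t. ?L (\<lambda>x. a * f x + b * g x) (x(i := t))) differentiable (at (x i))"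
    using DERIV_cong_ev[OF refl _ refl] by (fastforce simp: real_differentiable_def)
qed

lemma smooth_functions_zero: "(\<lambda>_. 0) \<in> smooth_functions n U"
proof -
  have "foldr partial_deriv is (\<lambda>_. 0) = (\<lambda>_. 0)" for "is"
    by (induction "is") (auto simp: partial_deriv_def)
  then show ?thesis by (simp add: smooth_functions_def smooth_on_def)
qed

lemma smooth_functions_linear:
  assumes "openin (Euclidean_space n) U" "f \<in> smooth_functions n U" "g \<in> smooth_functions n U"
  shows "(\<lambda>x. a * f x + b * g x) \<in> smooth_functions n U"
  using assms by (auto simp: smooth_functions_def intro: smooth_on_linear)

lemma smooth_functions_cmult:
  assumes "openin (Euclidean_space n) U" "f \<in> smooth_functions n U"
  shows "(\<lambda>x. a * f x) \<in> smooth_functions n U"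
  using smooth_functions_linear[OF assms assms(2), of a 0] by simp

lemma smooth_functions_sum:
  assumes "openin (Euclidean_space n) U" "\<And>s. s \<in> S \<Longrightarrow> f s \<in> smooth_functions n U"
  shows "(\<lambda>x. \<Sum>s\<in>S. f s x) \<in> smooth_functions n U"
  using assms(2)
\<comment> \<open>For infinite \<open>S\<close> the sum is 0 by convention, so that case is the zero
  function.\<close>
proof (induction S rule: infinite_finite_induct)
  case (insert s S)
  then show ?case
    using smooth_functions_linear[OF assms(1), of "f s" "\<lambda>x. \<Sum>s\<in>S. f s x" 1 1] by simp
qed (simp_all add: smooth_functions_zero)


section \<open>Degrees of products\<close>

lemma mono_mult_in_monomials:
  "a \<in> monomials C \<Longrightarrow> b \<in> monomials C \<Longrightarrow> mono_mult a b \<in> monomials C"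
  by (auto simp: monomials_def mono_mult_def)

text \<open>\<open>mono_mult\<close> takes the union of the odd parts, so without disjointness a
  common odd variable would be counted once instead of twice.\<close>

lemma mono_degree_mult:
  assumes "a \<in> monomials C" "b \<in> monomials C" "snd a \<inter> snd b = {}"
  shows "mono_degree C (mono_mult a b) = mono_degree C a + mono_degree C b"
proof -
  have "finite (snd a)" "finite (snd b)"
    using assms by (auto simp: monomials_def dest: finite_subset[OF _ finite_lessThan])
  then show ?thesis using assms(3)
    by (simp add: mono_degree_def mono_mult_def sum.union_disjoint sum.distrib distrib_right)
qed

text \<open>A contributing pair has non-zero sign, hence disjoint odd parts, so degrees add.\<close>

lemma series_mult_nonzero_degreeE:
  assumes "series_mult C f g m \<noteq> 0"
  obtains a b where "f a \<noteq> 0" "g b \<noteq> 0" "m \<in> monomials C"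
    "mono_degree C m = mono_degree C a + mono_degree C b"
proof -
  from assms obtain a b where ab: "a \<in> monomials C" "b \<in> monomials C" "mono_mult a b = m"
      "mono_sign a b * f a * g b \<noteq> 0"
    unfolding series_mult_def by (auto elim!: sum.not_neutral_contains_not_neutral)
  moreover have "snd a \<inter> snd b = {}" using ab(4) by (auto simp: mono_sign_def split: if_splits)
  ultimately show thesis
    using that[of a b] mono_degree_mult[of a C b] mono_mult_in_monomials[of a C b] by auto
qed

lemma mono_degree_one: "mono_degree C mono_one = 0"
  by (simp add: mono_degree_def mono_one_def)

lemma series_power_single_degree:
  assumes "mono_degree C z = 0" "series_power C (single z) n m \<noteq> 0"
  shows "mono_degree C m = 0"
  using assms(2)
proof (induction n arbitrary: m)
  case 0
  then show ?case by (auto simp: single_def mono_degree_one split: if_splits)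
next
  case (Suc n)
  then show ?case
    by (auto simp: single_def assms(1) elim!: series_mult_nonzero_degreeE split: if_splits)
qed

text \<open>Thus a substituted power series carries no degree, and each term of
  \<open>poly_times\<close> has the degree of a term of the polynomial.\<close>

lemma z_power_degree:
  assumes "\<forall>z\<in>set zs. mono_degree C z = 0" "length is = length zs" "z_power C zs is m \<noteq> 0"
  shows "mono_degree C m = 0"
  using assms
proof (induction zs "is" arbitrary: m rule: list_induct2')
  case 1
  then show ?case by (auto simp: z_power_def single_def mono_degree_one split: if_splits)
next
  case (4 z zs i "is")
  then have "series_mult C (series_power C (single z) i) (z_power C zs is) m \<noteq> 0"
    by (simp add: z_power_def)
  then show ?case
    by (rule series_mult_nonzero_degreeE) (use 4 in \<open>auto dest: series_power_single_degree\<close>)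
qed auto

section \<open>The inclusion of \<open>F_one\<close> in \<open>F_all\<close>\<close>

lemma F_one_subset_F_all:
  assumes U: "openin (Euclidean_space (base_dim C)) (base C)"
  shows "F_one C \<subseteq> F_all C"
proof
  fix f assume "f \<in> F_one C"
  then obtain zs N p F where
    zs: "\<forall>z \<in> set zs. z \<in> monomials C \<and> z \<noteq> mono_one \<and> mono_degree C z = 0" and
    p: "\<forall>s<N. p s \<in> polynomials C" and
    F: "\<forall>s<N. \<forall>is. length is = length zs \<longrightarrow> F s is \<in> smooth_functions (base_dim C) (base C)" and
    f: "f = (\<lambda>m x. \<Sum>s<(N::nat). poly_times C (p s) (substitute C zs (F s)) m x)"
    by (auto simp: F_one_def)
  \<comment> \<open>Only the finitely many degrees of terms of the polynomials can occur in
    \<open>f\<close>; \<open>g k\<close> is the part of \<open>f\<close> of degree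
    \<open>k\<close>.\<close>
  define K where "K = mono_degree C ` (\<Union>s<N. {m. p s m \<noteq> 0})"
  define g where "g k m = (if mono_degree C m = k then f m else (\<lambda>_. 0))" for k m
  have "finite K" using p by (auto simp: K_def polynomials_def)
  have "substitute C zs (F s) m \<in> smooth_functions (base_dim C) (base C)" if "s < N" for s m
    unfolding substitute_def mult.commute[of "F s _ _"] using that F
    by (intro smooth_functions_sum smooth_functions_cmult U) auto
  then have smooth: "f m \<in> smooth_functions (base_dim C) (base C)" for m
    unfolding f poly_times_def series_mult_def split_def
    by (intro smooth_functions_sum smooth_functions_cmult U) auto
  have supp: "m \<in> monomials C \<and> mono_degree C m \<in> K" if nz: "f m x \<noteq> 0" for m x
  proof -
    from nz obtain s where s: "s < N"
      "series_mult C (p s) (\<lambda>m'. substitute C zs (F s) m' x) m \<noteq> 0"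
      unfolding f poly_times_def by (auto elim!: sum.not_neutral_contains_not_neutral)
    from s(2) show ?thesis
    proof (rule series_mult_nonzero_degreeE)
      fix a b assume ab: "p s a \<noteq> 0" "substitute C zs (F s) b x \<noteq> 0" "m \<in> monomials C"
        "mono_degree C m = mono_degree C a + mono_degree C b"
      from ab(2) obtain "is" where "length is = length zs" "z_power C zs is b \<noteq> 0"
        unfolding substitute_def by (auto elim!: sum.not_neutral_contains_not_neutral)
      then have "mono_degree C b = 0" using zs by (intro z_power_degree) auto
      with ab s(1) show ?thesis by (auto simp: K_def)
    qed
  qed
  have "g k \<in> F_homogeneous C k" for k
  proof -
    have "f m = (\<lambda>_. 0)" if "m \<notin> monomials C" for m
      using supp that by (intro ext) blast
    then show ?thesis
      using smooth smooth_functions_zero by (simp add: F_homogeneous_def g_def)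
  qed
  moreover have "f m x = (\<Sum>k\<in>K. g k m x)" for m x
  proof -
    have "(\<Sum>k\<in>K. g k m x) = (\<Sum>k\<in>K. if mono_degree C m = k then f m x else 0)"
      by (rule sum.cong) (auto simp: g_def)
    \<comment> \<open>If the degree of \<open>m\<close> lies outside \<open>K\<close>, the sum is 0,
      and so is \<open>f m x\<close> by \<open>supp\<close>.\<close>
    then show ?thesis using \<open>finite K\<close> supp[of m x] by auto
  qed
  ultimately show "f \<in> F_all C"
    unfolding F_all_def using \<open>finite K\<close>
    by (intro CollectI exI[of _ K] exI[of _ g]) (simp add: fun_eq_iff)
qed


section \<open>Power series in even monomials\<close>

lemma series_mult_single:
  assumes "a \<in> monomials C" "m \<in> monomials C"
  shows "series_mult C (single a) g m =
         (\<Sum>b | b \<in> monomials C \<and> mono_mult a b = m. mono_sign a b * g b)"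
proof -
  let ?T = "{b. b \<in> monomials C \<and> mono_mult a b = m}"
  have "series_mult C (single a) g m =
        (\<Sum>(a', b) \<in> Pair a ` ?T. mono_sign a' b * single a a' * g b)"
    unfolding series_mult_def
    by (rule sum.mono_neutral_right[OF finite_mono_factorizations[OF assms(2)]])
       (use assms(1) in \<open>auto simp: single_def\<close>)
  also have "\<dots> = (\<Sum>b\<in>?T. mono_sign a b * g b)"
    by (subst sum.reindex) (auto simp: inj_on_def single_def)
  finally show ?thesis .
qed

lemma mono_sign_even: "snd b = {} \<Longrightarrow> mono_sign a b = 1"
  by (simp add: mono_sign_def)

text \<open>Exponents cancel, so \<open>a\<close> has at most one cofactor in \<open>m\<close>
  without odd variables, and the sign is 1. Truncated subtraction in \<open>b\<close> is harmless:
  the test \<open>mono_mult a b = m\<close> fails unless \<open>b\<close> is that cofactor.\<close>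

lemma series_mult_single_even:
  assumes "a \<in> monomials C" "m \<in> monomials C" "\<And>b. g b \<noteq> 0 \<Longrightarrow> snd b = {}"
  defines "b \<equiv> ((\<lambda>\<alpha>. fst m \<alpha> - fst a \<alpha>), {})"
  shows "series_mult C (single a) g m = (if mono_mult a b = m then g b else 0)"
proof -
  let ?T = "{b. b \<in> monomials C \<and> mono_mult a b = m}"
  have "finite (Pair a ` ?T)"
    by (rule finite_subset[OF _ finite_mono_factorizations[OF assms(2)]]) (use assms(1) in auto)
  then have fin: "finite ?T" by (rule finite_imageD) (simp add: inj_on_def)
  have b: "b \<in> monomials C" using assms(2) by (auto simp: monomials_def b_def)
  have uniq: "b' = b" if "mono_mult a b' = m" "snd b' = {}" for b'
    unfolding b_def that(1)[symmetric] using that(2) by (simp add: mono_mult_def prod_eq_iff)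
  have "series_mult C (single a) g m = (\<Sum>b'\<in>?T. mono_sign a b' * g b')"
    by (rule series_mult_single[OF assms(1,2)])
  also have "\<dots> = (\<Sum>b'\<in>?T. if b' = b then g b else 0)"
  proof (rule sum.cong[OF refl])
    fix b' assume "b' \<in> ?T"
    then have "mono_mult a b' = m" by simp
    show "mono_sign a b' * g b' = (if b' = b then g b else 0)"
    proof (cases "snd b' = {}")
      case True
      with \<open>mono_mult a b' = m\<close> have "b' = b" by (rule uniq)
      with True show ?thesis by (simp add: mono_sign_even)
    next
      case False
      then have "g b' = 0" "b' \<noteq> b" using assms(3)[of b'] unfolding b_def by force+
      then show ?thesis by simp
    qed
  qed
  also have "\<dots> = (if mono_mult a b = m then g b else 0)"
    using fin b by simp
  finally show ?thesis .
qed

lemma series_mult_single_single: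
  assumes "a \<in> monomials C" "b \<in> monomials C" "snd b = {}"
  shows "series_mult C (single a) (single b) = single (mono_mult a b)"
proof
  fix m
  show "series_mult C (single a) (single b) m = single (mono_mult a b) m"
  proof (cases "m \<in> monomials C")
    case True
    then show ?thesis
      using assms
      by (subst series_mult_single_even)
         (auto simp: single_def mono_mult_def fun_eq_iff prod_eq_iff split: if_splits)
  next
    case False
    then have "series_mult C (single a) (single b) m = 0"
      using series_mult_nonzero_degreeE by blast
    with False show ?thesis
      using mono_mult_in_monomials[OF assms(1,2)] by (auto simp: single_def)
  qed
qed

text \<open>Freedom from odd variables is stronger than even total degree: a product of two
  \<open>eta\<close>s is excluded.\<close>

definition even_monomials :: "('v, 'b) coord_chart_scheme \<Rightarrow> mono set" where
  "even_monomials C = {z \<in> monomials C. snd z = {}}"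

lemma series_power_even:
  assumes "z \<in> even_monomials C"
  shows "series_power C (single z) n = single ((\<lambda>\<alpha>. n * fst z \<alpha>), {})"
proof (induction n)
  case 0
  then show ?case by (simp add: mono_one_def)
next
  case (Suc n)
  then show ?case
    using assms
    by (simp, subst series_mult_single_single)
       (auto simp: even_monomials_def monomials_def mono_mult_def)
qed

text \<open>The single monomial to which \<open>z_power\<close> collapses when no odd variables
  occur.\<close>

definition even_power :: "mono list \<Rightarrow> nat list \<Rightarrow> mono" where
  "even_power zs is = ((\<lambda>\<alpha>. \<Sum>l<length zs. is ! l * fst (zs ! l) \<alpha>), {})"

lemma even_power_in_monomials:
  assumes "set zs \<subseteq> even_monomials C"
  shows "even_power zs is \<in> monomials C"
proof -
  have "fst (zs ! l) \<alpha> = 0" if "l < length zs" "n_even C \<le> \<alpha>" for l \<alpha>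
    using assms nth_mem[OF that(1)] that(2) by (auto simp: even_monomials_def monomials_def)
  then show ?thesis by (auto simp: monomials_def even_power_def)
qed

lemma z_power_even:
  assumes "set zs \<subseteq> even_monomials C" "length is = length zs"
  shows "z_power C zs is = single (even_power zs is)"
  using assms
proof (induction zs "is" rule: list_induct2')
  case 1
  then show ?case by (simp add: z_power_def even_power_def mono_one_def)
next
  case (4 z zs i "is")
  let ?z = "((\<lambda>\<alpha>. i * fst z \<alpha>), {})"
  have "z_power C (z # zs) (i # is) = series_mult C (series_power C (single z) i) (z_power C zs is)"
    by (simp add: z_power_def)
  also have "\<dots> = series_mult C (single ?z) (single (even_power zs is))"
    using 4 by (simp add: series_power_even)
  also have "\<dots> = single (mono_mult ?z (even_power zs is))"
  proof (rule series_mult_single_single)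
    show "?z \<in> monomials C" using 4 by (auto simp: even_monomials_def monomials_def)
    show "even_power zs is \<in> monomials C" using 4 by (intro even_power_in_monomials) auto
  qed (simp add: even_power_def)
  also have "mono_mult ?z (even_power zs is) = even_power (z # zs) (i # is)"
    by (simp add: even_power_def mono_mult_def sum.lessThan_Suc_shift del: sum.lessThan_Suc)
  finally show ?case .
qed auto

lemma even_power_update:
  assumes "l < length zs" "length is = length zs" "snd (zs ! l) = {}"
  shows "even_power zs (is[l := Suc (is ! l)]) = mono_mult (zs ! l) (even_power zs is)"
proof -
  have "(\<Sum>k<length zs. is[l := Suc (is ! l)] ! k * fst (zs ! k) \<alpha>) =
        (\<Sum>k<length zs. (if k = l then fst (zs ! k) \<alpha> else 0) + is ! k * fst (zs ! k) \<alpha>)" for \<alpha>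
    by (rule sum.cong) (use assms in \<open>auto simp: nth_list_update\<close>)
  then show ?thesis
    using assms by (simp add: even_power_def mono_mult_def sum.distrib)
qed

text \<open>Substitution gathers all multi-indices with the same \<open>even_power\<close>; there
  may be several, since the monomials in \<open>zs\<close> can satisfy relations. Multiplication by
  \<open>a\<close> then shifts exponents.\<close>

lemma poly_times_single_even:
  assumes zs: "set zs \<subseteq> even_monomials C" and a: "a \<in> monomials C" and m: "m \<in> monomials C"
  defines "b \<equiv> ((\<lambda>\<alpha>. fst m \<alpha> - fst a \<alpha>), {})"
  shows "poly_times C (single a) (substitute C zs F) m x =
    (if mono_mult a b = m then \<Sum>is | length is = length zs \<and> even_power zs is = b. F is x else 0)"
proof -
  have subst: "substitute C zs F b' x =
      (\<Sum>is | length is = length zs \<and> even_power zs is = b'. F is x)" for b'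
    unfolding substitute_def
    by (rule sum.cong) (auto simp: z_power_even[OF zs] single_def split: if_splits)
  have "snd b' = {}" if "substitute C zs F b' x \<noteq> 0" for b'
    using that unfolding subst
    by (auto simp: even_power_def elim!: sum.not_neutral_contains_not_neutral)
  then show ?thesis
    unfolding poly_times_def b_def
    by (subst series_mult_single_even[OF a m]) (auto simp: subst)
qed


section \<open>Dividing by monomials of degree zero\<close>

text \<open>Each variable is raised to the absolute degree of the other. Under the sign conditions
  of \<open>balanced_monos\<close>, \<open>nat\<close> loses nothing and
  \<open>\<alpha> \<noteq> \<beta>\<close>.\<close>

definition balanced_mono :: "('v, 'b) coord_chart_scheme \<Rightarrow> nat \<Rightarrow> nat \<Rightarrow> mono" where
  "balanced_mono C \<alpha> \<beta> =
     ((\<lambda>\<gamma>. (if \<gamma> = \<alpha> then nat (- deg_zeta C \<beta>) else 0) + (if \<gamma> = \<beta> then nat (deg_zeta C \<alpha>) else 0)), {})"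

definition balanced_monos :: "('v, 'b) coord_chart_scheme \<Rightarrow> mono set" where
  "balanced_monos C = {balanced_mono C \<alpha> \<beta> | \<alpha> \<beta>.
     \<alpha> < n_even C \<and> \<beta> < n_even C \<and> deg_zeta C \<alpha> > 0 \<and> deg_zeta C \<beta> < 0}"

lemma finite_balanced_monos: "finite (balanced_monos C)"
proof -
  have "balanced_monos C \<subseteq> (\<lambda>(\<alpha>, \<beta>). balanced_mono C \<alpha> \<beta>) ` ({..<n_even C} \<times> {..<n_even C})"
    by (auto simp: balanced_monos_def)
  then show ?thesis by (rule finite_subset) auto
qed

lemma balanced_monos_even: "balanced_monos C \<subseteq> even_monomials C"
  by (auto simp: balanced_monos_def balanced_mono_def even_monomials_def monomials_def)

lemma balanced_monos_degree:
  assumes "z \<in> balanced_monos C"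
  shows "mono_degree C z = 0"
proof -
  from assms obtain \<alpha> \<beta> where *: "z = balanced_mono C \<alpha> \<beta>" "\<alpha> < n_even C" "\<beta> < n_even C"
    "deg_zeta C \<alpha> > 0" "deg_zeta C \<beta> < 0" by (auto simp: balanced_monos_def)
  \<comment> \<open>Each \<open>if\<close> picks out one index, and the two resulting products of
    degrees cancel.\<close>
  have "mono_degree C z = (\<Sum>\<gamma><n_even C.
      (if \<gamma> = \<alpha> then - deg_zeta C \<beta> * deg_zeta C \<gamma> else 0) +
      (if \<gamma> = \<beta> then deg_zeta C \<alpha> * deg_zeta C \<gamma> else 0))"
    unfolding mono_degree_def * balanced_mono_def fst_conv snd_conv sum.empty add_0_right
    by (rule sum.cong) (use * in auto)
  then show ?thesis using * by (simp add: sum.distrib)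
qed

text \<open>Serves twice: repeated division terminates, and these monomials differ from
  \<open>mono_one\<close>.\<close>

lemma balanced_monos_size:
  assumes "z \<in> balanced_monos C"
  shows "mono_size C z > 0"
proof -
  from assms obtain \<alpha> \<beta> where *: "z = balanced_mono C \<alpha> \<beta>" "\<alpha> < n_even C" "\<beta> < n_even C"
    "deg_zeta C \<alpha> > 0" "deg_zeta C \<beta> < 0" by (auto simp: balanced_monos_def)
  have "0 < fst z \<alpha>" using * by (simp add: balanced_mono_def)
  also have "\<dots> \<le> (\<Sum>\<alpha><n_even C. fst z \<alpha>)" using * by (intro member_le_sum) auto
  finally show ?thesis by (simp add: mono_size_def)
qed

text \<open>Comparing even exponents suffices for divisors without odd variables.\<close>

definition mono_divides :: "mono \<Rightarrow> mono \<Rightarrow> bool" where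
  "mono_divides z m \<longleftrightarrow> (\<forall>\<gamma>. fst z \<gamma> \<le> fst m \<gamma>)"

definition remainders :: "('v, 'b) coord_chart_scheme \<Rightarrow> int set \<Rightarrow> mono set" where
  "remainders C K = {m \<in> monomials C. mono_degree C m \<in> K \<and>
     (\<forall>z\<in>balanced_monos C. \<not> mono_divides z m)}"

text \<open>Dividing by a balanced monomial keeps the degree and strictly lowers
  \<open>mono_size\<close>, which drives the induction.\<close>

lemma remainder_decomposition:
  assumes zs: "set zs = balanced_monos C"
    and "m \<in> monomials C" "mono_degree C m \<in> K"
  shows "\<exists>r\<in>remainders C K. \<exists>is. length is = length zs \<and> m = mono_mult r (even_power zs is)"
  using assms(2,3)
proof (induction "mono_size C m" arbitrary: m rule: less_induct)
  case less
  show ?case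
  proof (cases "\<exists>z\<in>balanced_monos C. mono_divides z m")
    case False
    then have "m \<in> remainders C K" using less.prems by (simp add: remainders_def)
    moreover have "m = mono_mult m (even_power zs (replicate (length zs) 0))"
      by (auto simp: mono_mult_def even_power_def prod_eq_iff)
    ultimately show ?thesis by (metis length_replicate)
  next
    case True
    then obtain z where z: "z \<in> balanced_monos C" "mono_divides z m" by blast
    \<comment> \<open>The quotient: the subtraction is exact because \<open>z\<close> divides
      \<open>m\<close>, and the odd part stays untouched.\<close>
    define m' where "m' = ((\<lambda>\<gamma>. fst m \<gamma> - fst z \<gamma>), snd m)"
    have ze: "z \<in> monomials C" "snd z = {}"
      using balanced_monos_even z by (auto simp: even_monomials_def)
    have m': "m' \<in> monomials C" using less.prems by (auto simp: m'_def monomials_def)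
    have eq: "m = mono_mult m' z"
      using z(2) ze by (auto simp: m'_def mono_mult_def mono_divides_def prod_eq_iff)
    have "mono_degree C m' \<in> K"
      using less.prems balanced_monos_degree[OF z(1)] mono_degree_mult[OF m' ze(1)] ze eq by simp
    moreover have "mono_size C m = mono_size C m' + mono_size C z"
      using ze by (simp add: eq mono_size_def mono_mult_def sum.distrib)
    then have "mono_size C m' < mono_size C m" using balanced_monos_size[OF z(1)] by simp
    ultimately obtain r "is" where r: "r \<in> remainders C K" "length is = length zs"
        "m' = mono_mult r (even_power zs is)"
      using less.hyps m' by blast
    \<comment> \<open>Any position of \<open>z\<close> in \<open>zs\<close> serves; raising its
      exponent by one restores the factor \<open>z\<close>.\<close>
    from z zs obtain l where l: "l < length zs" "zs ! l = z" by (metis in_set_conv_nth)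
    have "m = mono_mult r (even_power zs (is[l := Suc (is ! l)]))"
      using even_power_update[OF l(1) r(2)] l(2) ze
      by (simp add: eq r(3) mono_mult_def fun_eq_iff Un_ac)
    with r show ?thesis by (metis length_list_update)
  qed
qed

text \<open>Bounded exponents at positive degrees bound the positive part of the sum of
  \<open>i d\<close>; given the sum itself, the negative part is bounded too. Each exponent is at
  most its contribution, as \<open>d\<close> is a non-zero integer.\<close>

lemma exponent_bound:
  fixes d :: "nat \<Rightarrow> int" and i :: "nat \<Rightarrow> nat"
  assumes "\<And>\<gamma>. \<gamma> < n \<Longrightarrow> d \<gamma> \<noteq> 0"
    and "\<And>\<gamma>. \<gamma> < n \<Longrightarrow> d \<gamma> > 0 \<Longrightarrow> int (i \<gamma>) \<le> D" "0 \<le> D" "\<gamma> < n"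
  shows "int (i \<gamma>) \<le> 2 * D * (\<Sum>\<gamma><n. \<bar>d \<gamma>\<bar>) - (\<Sum>\<gamma><n. int (i \<gamma>) * d \<gamma>)"
proof -
  have "int (i \<gamma>) * 1 \<le> int (i \<gamma>) * \<bar>d \<gamma>\<bar>"
    using assms(1)[OF assms(4)] by (intro mult_left_mono) auto
  also have "\<dots> \<le> (\<Sum>\<gamma><n. int (i \<gamma>) * \<bar>d \<gamma>\<bar>)"
    using assms(4) by (intro member_le_sum) auto
  \<comment> \<open>Termwise: for \<open>d > 0\<close> this says
    \<open>2 * i * d \<le> 2 * D * d\<close>; for negative \<open>d\<close> the sides differ by
    \<open>2 * D * \<bar>d\<bar> \<ge> 0\<close>.\<close>
  also have "\<dots> \<le> (\<Sum>\<gamma><n. 2 * D * \<bar>d \<gamma>\<bar> - int (i \<gamma>) * d \<gamma>)"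
  proof (rule sum_mono)
    fix \<gamma> assume "\<gamma> \<in> {..<n}"
    then show "int (i \<gamma>) * \<bar>d \<gamma>\<bar> \<le> 2 * D * \<bar>d \<gamma>\<bar> - int (i \<gamma>) * d \<gamma>"
      using assms(2)[of \<gamma>] assms(3) mult_right_mono[of "int (i \<gamma>)" D "d \<gamma>"]
      by (cases "d \<gamma> > 0") (auto simp: mult_nonneg_nonpos)
  qed
  also have "\<dots> = 2 * D * (\<Sum>\<gamma><n. \<bar>d \<gamma>\<bar>) - (\<Sum>\<gamma><n. int (i \<gamma>) * d \<gamma>)"
    by (simp add: sum_subtractf sum_distrib_left)
  finally show ?thesis by simp
qed

lemma finite_remainders:
  assumes nz: "\<forall>\<alpha><n_even C. deg_zeta C \<alpha> \<noteq> 0" and K: "finite K"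
  shows "finite (remainders C K)"
proof -
  let ?n = "n_even C" and ?d = "deg_zeta C"
  \<comment> \<open>\<open>D\<close> dominates every exponent in a balanced monomial.
    \<open>T\<close> bounds the degree of the even part of a remainder: a total degree in
    \<open>K\<close> minus the degrees of odd factors. \<open>B\<close> is the bound that
    \<open>exponent_bound\<close> then yields.\<close>
  define D where "D = (\<Sum>\<gamma><?n. \<bar>?d \<gamma>\<bar>)"
  define T where "T = (\<Sum>k\<in>K. \<bar>k\<bar>) + (\<Sum>\<beta><n_odd C. \<bar>deg_eta C \<beta>\<bar>)"
  define B where "B = nat (2 * D * D + T)"
  have D0: "0 \<le> D" by (simp add: D_def sum_nonneg)
  have dD: "\<bar>?d \<gamma>\<bar> \<le> D" if "\<gamma> < ?n" for \<gamma>
    unfolding D_def using that by (intro member_le_sum) auto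
  have bound: "fst m \<gamma> \<le> B" if m: "m \<in> remainders C K" and \<gamma>: "\<gamma> < ?n" for m \<gamma>
  proof -
    let ?t = "\<Sum>\<gamma><?n. int (fst m \<gamma>) * ?d \<gamma>"
    have J: "snd m \<subseteq> {..<n_odd C}" and k: "mono_degree C m \<in> K"
      using m by (auto simp: remainders_def monomials_def)
    have "?t = mono_degree C m - (\<Sum>\<beta>\<in>snd m. deg_eta C \<beta>)" by (simp add: mono_degree_def)
    moreover have "\<bar>mono_degree C m\<bar> \<le> (\<Sum>k\<in>K. \<bar>k\<bar>)" using k K by (intro member_le_sum) auto
    moreover have "\<bar>\<Sum>\<beta>\<in>snd m. deg_eta C \<beta>\<bar> \<le> (\<Sum>\<beta>\<in>snd m. \<bar>deg_eta C \<beta>\<bar>)" by (rule sum_abs)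
    moreover have "(\<Sum>\<beta>\<in>snd m. \<bar>deg_eta C \<beta>\<bar>) \<le> (\<Sum>\<beta><n_odd C. \<bar>deg_eta C \<beta>\<bar>)"
      using J by (intro sum_mono2) auto
    ultimately have t: "\<bar>?t\<bar> \<le> T" unfolding T_def by linarith
    have small: "int (fst m \<alpha>) \<le> D \<or> int (fst m \<beta>) \<le> D"
      if "\<alpha> < ?n" "\<beta> < ?n" "?d \<alpha> > 0" "?d \<beta> < 0" for \<alpha> \<beta>
    proof (rule ccontr)
      assume *: "\<not> ?thesis"
      \<comment> \<open>Two exponents above \<open>D\<close> leave room for the balanced monomial,
        which a remainder forbids.\<close>
      have "mono_divides (balanced_mono C \<alpha> \<beta>) m"
        using * that dD[of \<alpha>] dD[of \<beta>] by (auto simp: mono_divides_def balanced_mono_def)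
      moreover have "balanced_mono C \<alpha> \<beta> \<in> balanced_monos C"
        using that by (auto simp: balanced_monos_def)
      ultimately show False using m by (auto simp: remainders_def)
    qed
    have "int (fst m \<gamma>) \<le> 2 * D * D + T"
    proof (cases "\<forall>\<alpha><?n. ?d \<alpha> > 0 \<longrightarrow> int (fst m \<alpha>) \<le> D")
      case True
      then have "int (fst m \<gamma>) \<le> 2 * D * D - ?t"
        unfolding D_def using nz \<gamma> D0 by (intro exponent_bound) (auto simp: D_def)
      with t show ?thesis by linarith
    next
      case False
      \<comment> \<open>Some exponent at positive degree exceeds \<open>D\<close>, so all those at
        negative degree are small; \<open>exponent_bound\<close> applies with the degrees
        negated.\<close>
      then have "\<forall>\<beta><?n. - ?d \<beta> > 0 \<longrightarrow> int (fst m \<beta>) \<le> D" using small by auto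
      then have "int (fst m \<gamma>) \<le> 2 * D * (\<Sum>\<gamma><?n. \<bar>- ?d \<gamma>\<bar>) - (\<Sum>\<gamma><?n. int (fst m \<gamma>) * - ?d \<gamma>)"
        using nz \<gamma> D0 by (intro exponent_bound) auto
      also have "\<dots> = 2 * D * D + ?t" by (simp add: D_def sum_negf)
      finally show ?thesis using t by linarith
    qed
    then show ?thesis unfolding B_def by linarith
  qed
  let ?E = "{e. \<forall>\<alpha>. (\<alpha> \<in> {..<?n} \<longrightarrow> e \<alpha> \<in> {..B}) \<and> (\<alpha> \<notin> {..<?n} \<longrightarrow> e \<alpha> = (0::nat))}"
  have "remainders C K \<subseteq> ?E \<times> Pow {..<n_odd C}"
  proof
    fix m assume m: "m \<in> remainders C K"
    then have "m \<in> monomials C" by (simp add: remainders_def)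
    with bound[OF m] show "m \<in> ?E \<times> Pow {..<n_odd C}" by (cases m) (auto simp: monomials_def)
  qed
  moreover have "finite (?E \<times> Pow {..<n_odd C})"
    by (intro finite_cartesian_product finite_set_of_finite_funs) auto
  ultimately show ?thesis by (rule finite_subset)
qed

section \<open>The inclusion of \<open>F_all\<close> in \<open>F_one\<close>\<close>

lemma F_all_subset_F_one:
  assumes U: "openin (Euclidean_space (base_dim C)) (base C)"
    and nz: "\<forall>\<alpha><n_even C. deg_zeta C \<alpha> \<noteq> 0"
  shows "F_all C \<subseteq> F_one C"
proof
  fix f assume "f \<in> F_all C"
  then obtain K g where K: "finite K" and g: "\<forall>k\<in>K. g k \<in> F_homogeneous C k"
    and f: "f = (\<lambda>m x. \<Sum>k\<in>K. g k m x)" by (auto simp: F_all_def)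
  define M where "M = {m \<in> monomials C. mono_degree C m \<in> K}"
  have smooth: "f m \<in> smooth_functions (base_dim C) (base C)" for m
    unfolding f using g by (intro smooth_functions_sum U) (unfold F_homogeneous_def, blast)
  have supp: "f m x = 0" if "m \<notin> M" for m x
  proof -
    have "g k m = (\<lambda>_. 0)" if "k \<in> K" for k
    proof -
      have "g k \<in> F_homogeneous C k" "m \<notin> monomials C \<or> mono_degree C m \<noteq> k"
        using g that \<open>m \<notin> M\<close> by (auto simp: M_def)
      then show ?thesis by (simp add: F_homogeneous_def del: split_paired_All)
    qed
    then show ?thesis by (simp add: f)
  qed

  obtain zs where zs: "set zs = balanced_monos C"
    using finite_list[OF finite_balanced_monos] by blast
  have zs_even: "set zs \<subseteq> even_monomials C" using zs balanced_monos_even by simp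
  have "\<forall>m\<in>M. \<exists>r is. r \<in> remainders C K \<and> length is = length zs \<and>
      mono_mult r (even_power zs is) = m"
    using remainder_decomposition[OF zs] by (fastforce simp: M_def)
  then obtain r e where re: "\<And>m. m \<in> M \<Longrightarrow>
      r m \<in> remainders C K \<and> length (e m) = length zs \<and> mono_mult (r m) (even_power zs (e m)) = m"
    by metis
  \<comment> \<open>\<open>F_one\<close> numbers its summands, so \<open>q\<close> enumerates the
    remainders; the polynomial with number \<open>s\<close> will be the monomial
    \<open>q s\<close>.\<close>
  define N where "N = card (remainders C K)"
  obtain q where q: "bij_betw q {..<N} (remainders C K)"
    using ex_bij_betw_nat_finite[OF finite_remainders[OF nz K]]
    by (auto simp: N_def lessThan_atLeast0)
  have q_mono: "q s \<in> monomials C" if "s < N" for s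
    using that bij_betwE[OF q] by (auto simp: remainders_def)
  text \<open>A monomial \<open>m\<close> may be the product of remainders and powers of \<open>zs\<close> in several ways; only the
    chosen one, \<open>r m\<close> and \<open>e m\<close>, receives its coefficient.\<close>
  define F where "F s is = (let m = mono_mult (q s) (even_power zs is) in
      if m \<in> M \<and> r m = q s \<and> e m = is then f m else (\<lambda>_. 0))" for s "is"
  have "f m x = (\<Sum>s<N. poly_times C (single (q s)) (substitute C zs (F s)) m x)" for m x
  proof (cases "m \<in> monomials C")
    case False
    then have "poly_times C (single (q s)) (substitute C zs (F s)) m x = 0" for s
      unfolding poly_times_def using series_mult_nonzero_degreeE by blast
    with supp[of m x] False show ?thesis by (simp add: M_def)
  next
    case m: True
    have "poly_times C (single (q s)) (substitute C zs (F s)) m x =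
          (if m \<in> M \<and> r m = q s then f m x else 0)" if s: "s < N" for s
    proof -
      let ?b = "((\<lambda>\<alpha>. fst m \<alpha> - fst (q s) \<alpha>), {})"
      let ?I = "{is. length is = length zs \<and> even_power zs is = ?b}"
      \<comment> \<open>Finiteness of \<open>?I\<close> is what allows its one surviving term to be
        extracted below, since infinite sums are 0 by convention.\<close>
      have "finite {is. length is = length zs \<and> z_power C zs is ?b \<noteq> 0}"
        using zs_even balanced_monos_size[of mono_one C] zs
        by (intro finite_z_power_support)
           (auto simp: even_monomials_def mono_size_def mono_one_def)
      also have "{is. length is = length zs \<and> z_power C zs is ?b \<noteq> 0} = ?I"
        by (auto simp: z_power_even[OF zs_even] single_def split: if_splits)
      finally have fin: "finite ?I" .
      have eq: "poly_times C (single (q s)) (substitute C zs (F s)) m x =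
          (if mono_mult (q s) ?b = m then \<Sum>is\<in>?I. F s is x else 0)"
        by (rule poly_times_single_even[OF zs_even q_mono[OF s] m, of "F s" x])
      \<comment> \<open>Cancel the exponents of \<open>q s\<close> in the chosen factorization of
        \<open>m\<close>.\<close>
      have b_eq: "even_power zs (e m) = ?b" if "m \<in> M" "r m = q s"
      proof -
        have "mono_mult (q s) (even_power zs (e m)) = m" using re[OF that(1)] that(2) by simp
        then have "fst (mono_mult (q s) (even_power zs (e m))) \<alpha> = fst m \<alpha>" for \<alpha>
          by (simp only:)
        then have "fst (q s) \<alpha> + fst (even_power zs (e m)) \<alpha> = fst m \<alpha>" for \<alpha>
          by (simp only: mono_mult_def fst_conv)
        then have "fst (even_power zs (e m)) \<alpha> = fst m \<alpha> - fst (q s) \<alpha>" for \<alpha>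
          by (metis add_diff_cancel_left')
        then show ?thesis by (simp add: even_power_def)
      qed
      show ?thesis
      proof (cases "mono_mult (q s) ?b = m")
        case True
        \<comment> \<open>Every \<open>is\<close> in \<open>?I\<close> recombines with
          \<open>q s\<close> to \<open>m\<close> itself, so the test in \<open>F\<close> leaves only
          \<open>is = e m\<close>.\<close>
        have "(\<Sum>is\<in>?I. F s is x) =
            (\<Sum>is\<in>?I. if is = e m then (if m \<in> M \<and> r m = q s then f m x else 0) else 0)"
          by (rule sum.cong) (auto simp: F_def Let_def True)
        also have "\<dots> = (if m \<in> M \<and> r m = q s then f m x else 0)"
        proof -
          have "e m \<in> ?I" if "m \<in> M" "r m = q s"
            using b_eq re[of m] that by auto
          then show ?thesis using fin by auto
        qed
        finally show ?thesis using True eq by simp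
      next
        case False
        \<comment> \<open>If \<open>q s\<close> were the chosen remainder of \<open>m\<close>, then
          \<open>?b\<close> would be its cofactor by \<open>b_eq\<close>.\<close>
        then have "\<not> (m \<in> M \<and> r m = q s)" using b_eq re[of m] by auto
        with False eq show ?thesis by auto
      qed
    qed
    then have "(\<Sum>s<N. poly_times C (single (q s)) (substitute C zs (F s)) m x) =
        (\<Sum>s<N. if m \<in> M \<and> r m = q s then f m x else 0)" by simp
    also have "\<dots> = (\<Sum>a\<in>remainders C K. if m \<in> M \<and> r m = a then f m x else 0)"
      by (rule sum.reindex_bij_betw[OF q])
    \<comment> \<open>For \<open>m\<close> in \<open>M\<close> exactly the term
      \<open>a = r m\<close> survives; otherwise both sides vanish by \<open>supp\<close>.\<close>
    also have "\<dots> = f m x"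
      using re[of m] supp[of m x] finite_remainders[OF nz K]
      by (cases "m \<in> M") auto
    finally show ?thesis by simp
  qed
  moreover have "\<forall>z\<in>set zs. z \<in> monomials C \<and> z \<noteq> mono_one \<and> mono_degree C z = 0"
    using zs zs_even balanced_monos_degree balanced_monos_size[of mono_one C]
    by (auto simp: even_monomials_def mono_size_def mono_one_def)
  moreover have "\<forall>s<N. single (q s) \<in> polynomials C"
    using q_mono by (auto simp: polynomials_def single_def)
  moreover have "\<forall>s<N. \<forall>is. length is = length zs \<longrightarrow> F s is \<in> smooth_functions (base_dim C) (base C)"
    using smooth smooth_functions_zero by (auto simp: F_def Let_def)
  ultimately show "f \<in> F_one C"
    unfolding F_one_def
    by (intro CollectI exI[of _ zs] exI[of _ N] exI[of _ "\<lambda>s. single (q s)"] exI[of _ F] conjI ext)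
qed

theorem proposition4:
  fixes C :: "'v::real_vector coord_chart"
  assumes "graded_chart C" and "homogeneous_coordinates C"
  shows "F_one C = F_all C"
proof (rule equalityI)
  have U: "openin (Euclidean_space (base_dim C)) (base C)"
    using assms(1) by (simp add: graded_chart_def)
  then show "F_one C \<subseteq> F_all C" by (rule F_one_subset_F_all)
  show "F_all C \<subseteq> F_one C"
    using assms(2) U by (intro F_all_subset_F_one) (auto simp: homogeneous_coordinates_def)
qed

end
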